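(* Let $R\in\mathcal R_{\rm s}^{n_y}$. Let $A$ be the nominal closed-loop matrix (the matrix $A_R$ with $R=I$), let $P=P^{\top}>0$ satisfy $AP+PA^{\top}+BB^{\top}=0$, let $P_R$ satisfy $A_RP_R+P_RA_R^{\top}+BB^{\top}=0$, and set $\Delta P_R=P_R-P$, $E_R=(I-R)C_{\rm m,o}$, $C_{\rm r}=[0,\ C_{\rm m,o}]$. Assume that $\|\Delta P_R\|_2\le\delta_R\|P\|_2$ for some $\delta_R\in[0,1)$ and that $\delta_R\,\kappa(P)<1$. Then $$\frac{\operatorname{tr}\{C_{\rm p}P_RC_{\rm p}^{\top}\}}{\operatorname{tr}\{C_{{\rm r},R}P_RC_{{\rm r},R}^{\top}\}}\le \frac{\kappa(P)(1+\delta_R)}{1-\delta_R\kappa(P)}\cdot\frac{\|C_{\rm p}\|_F^2}{\|E_R\|_F^2+\|C_{\rm r}\|_F^2}.$$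
   Context: Data: $A_{\rm p}\in\mathbb R^{n_x\times n_x}$, $B_{\rm p}\in\mathbb R^{n_x\times n_u}$, $B_w,B_{\hat w}\in\mathbb R^{n_x\times n_x}$, $C_{\rm m,o}\in\mathbb R^{n_y\times n_x}$, $C_{\rm p,o}\in\mathbb R^{n_{y_{\rm p}}\times n_x}$, $D_{\rm p,o}\in\mathbb R^{n_{y_{\rm p}}\times n_u}$, $K\in\mathbb R^{n_x\times n_y}$, $L\in\mathbb R^{n_u\times n_x}$, with $(A_{\rm p},B_{\rm p})$ controllable and $(A_{\rm p},C_{\rm m,o})$ observable. For $R\in\mathbb R^{n_y\times n_y}$: $$A_R=\begin{bmatrix}A_{\rm p}+B_{\rm p}L & -B_{\rm p}L\\ K(I-R)C_{\rm m,o} & A_{\rm p}-KC_{\rm m,o}\end{bmatrix},\quad B=\begin{bmatrix}B_w&0\\ B_w&-B_{\hat w}\end{bmatrix},$$ $C_{{\rm r},R}=[(R-I)C_{\rm m,o},\ C_{\rm m,o}]$, $C_{\rm p}=[C_{\rm p,o}+D_{\rm p,o}L,\ -D_{\rm p,o}L]$. So $A=A_I=\begin{bmatrix}A_{\rm p}+B_{\rm p}L & -B_{\rm p}L\\ 0 & A_{\rm p}-KC_{\rm m,o}\end{bmatrix}$. $\mathcal R_{\rm s}^{n_y}=\{R: A_R\text{ is Hurwitz}\}$. $\|\cdot\|_2$ is the spectral norm, $\|\cdot\|_F$ the Frobenius norm, and for symmetric positive definite $P$, $\kappa(P)=\lambda_{\max}(P)/\lambda_{\min}(P)$. *)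

theory Defs
  imports "HOL-Analysis.Analysis"
begin

(* 2x2 block matrix [[M11, M12],[M21, M22]]; the block index type is 'a + 'b *)
definition blk :: "real^'b^'a \<Rightarrow> real^'d^'a \<Rightarrow> real^'b^'c \<Rightarrow> real^'d^'c \<Rightarrow> real^('b + 'd)^('a + 'c)" where
  "blk M11 M12 M21 M22 = (\<chi> i j. case i of
      Inl a \<Rightarrow> (case j of Inl b \<Rightarrow> M11 $ a $ b | Inr d \<Rightarrow> M12 $ a $ d)
    | Inr c \<Rightarrow> (case j of Inl b \<Rightarrow> M21 $ c $ b | Inr d \<Rightarrow> M22 $ c $ d))"

(* 1x2 block row [M1, M2] *)
definition brow :: "real^'b^'a \<Rightarrow> real^'d^'a \<Rightarrow> real^('b + 'd)^'a" where
  "brow M1 M2 = (\<chi> i j. case j of Inl b \<Rightarrow> M1 $ i $ b | Inr d \<Rightarrow> M2 $ i $ d)"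

(* complexification of a real square matrix *)
definition cmat :: "real^'n^'n \<Rightarrow> complex^'n^'n" where
  "cmat M = (\<chi> i j. complex_of_real (M $ i $ j))"

(* Hurwitz: every (complex) eigenvalue, i.e. root of det(sI - M), has negative real part *)
definition hurwitz :: "real^'n^'n \<Rightarrow> bool" where
  "hurwitz M \<longleftrightarrow> (\<forall>s::complex. det (mat s - cmat M) = 0 \<longrightarrow> Re s < 0)"

(* Kalman controllability: [B, AB, ..., A^(n-1)B] has full row rank *)
definition controllable :: "real^'n^'n \<Rightarrow> real^'m^'n \<Rightarrow> bool" where
  "controllable M N \<longleftrightarrow>
     (\<forall>v::real^'n. (\<forall>k<CARD('n). \<forall>u. v \<bullet> ((((**) M) ^^ k) N *v u) = 0) \<longrightarrow> v = 0)"

(* Kalman observability: [C; CA; ...; CA^(n-1)] has full column rank *)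
definition observable :: "real^'n^'n \<Rightarrow> real^'n^'m \<Rightarrow> bool" where
  "observable M C \<longleftrightarrow>
     (\<forall>x::real^'n. (\<forall>k<CARD('n). (C ** ((((**) M) ^^ k) (mat 1))) *v x = 0) \<longrightarrow> x = 0)"

definition sym_pos_def :: "real^'n^'n \<Rightarrow> bool" where
  "sym_pos_def P \<longleftrightarrow> transpose P = P \<and> (\<forall>x. x \<noteq> 0 \<longrightarrow> x \<bullet> (P *v x) > 0)"

(* real eigenvalues of a real square matrix *)
definition real_eigenvalues :: "real^'n^'n \<Rightarrow> real set" where
  "real_eigenvalues M = {l. \<exists>v. v \<noteq> 0 \<and> M *v v = l *\<^sub>R v}"

definition lambda_max :: "real^'n^'n \<Rightarrow> real" where
  "lambda_max M = Max (real_eigenvalues M)"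

definition lambda_min :: "real^'n^'n \<Rightarrow> real" where
  "lambda_min M = Min (real_eigenvalues M)"

definition cond_num :: "real^'n^'n \<Rightarrow> real" where
  "cond_num M = lambda_max M / lambda_min M"

(* spectral norm (induced 2-norm) *)
definition spec_norm :: "real^'n^'m \<Rightarrow> real" where
  "spec_norm M = onorm (\<lambda>x. M *v x)"

(* Frobenius norm *)
definition frob_norm :: "real^'n^'m \<Rightarrow> real" where
  "frob_norm M = sqrt (\<Sum>i\<in>UNIV. \<Sum>j\<in>UNIV. (M $ i $ j)\<^sup>2)"

(* closed-loop matrix A_R *)
definition A_cl :: "real^'x^'x \<Rightarrow> real^'u^'x \<Rightarrow> real^'y^'x \<Rightarrow> real^'x^'u \<Rightarrow> real^'x^'y
    \<Rightarrow> real^'y^'y \<Rightarrow> real^('x + 'x)^('x + 'x)" where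
  "A_cl Ap Bp K L Cmo R =
     blk (Ap + Bp ** L) (- (Bp ** L)) (K ** (mat 1 - R) ** Cmo) (Ap - K ** Cmo)"

end

theory Submission
  imports Defs
begin

(* Since P is symmetric positive definite, lambda_min(P) |x|^2 <= x'Px <= lambda_max(P) |x|^2,
   and the perturbation P_R - P has spectral norm at most delta ||P|| <= delta lambda_max(P), so
   (lambda_min - delta lambda_max) |x|^2 <= x'P_R x <= (1 + delta) lambda_max |x|^2.
   Summing over the rows of C gives the same bounds for tr(C P_R C') with |x|^2 replaced by
   ||C||_F^2; dividing the upper bound for C_p by the lower bound for C_{r,R}, and splitting
   ||C_{r,R}||_F^2 = ||E_R||_F^2 + ||C_r||_F^2 over the two blocks, gives the claim. *)

lemma matrix_mul_uminus_left: "(- A) ** B = - (A ** (B :: 'a::ring_1^'n^'m))"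
  by (simp add: matrix_matrix_mult_def vec_eq_iff sum_negf)

lemma matrix_vector_mult_uminus_left: "(- A) *v x = - (A *v (x :: 'a::ring_1^'n))"
  by (simp add: matrix_vector_mult_def vec_eq_iff sum_negf)

lemma symmetric_matrix_inner_commute:
  fixes P :: "real^'n^'n"
  assumes "transpose P = P"
  shows "x \<bullet> (P *v y) = y \<bullet> (P *v x)"
proof -
  have "x \<bullet> (P *v y) = (x v* P) \<bullet> y" by (simp add: dot_lmul_matrix)
  also have "x v* P = P *v x" by (metis assms transpose_matrix_vector)
  finally show ?thesis by (simp add: inner_commute)
qed

lemma psd_form_Cauchy_Schwarz:
  fixes Q :: "real^'n^'n"
  assumes sym: "transpose Q = Q" and psd: "\<And>z. 0 \<le> z \<bullet> (Q *v z)"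
  shows "(y \<bullet> (Q *v x))\<^sup>2 \<le> (x \<bullet> (Q *v x)) * (y \<bullet> (Q *v y))"
proof -
  define a b c where "a = x \<bullet> (Q *v x)" and "b = y \<bullet> (Q *v x)" and "c = y \<bullet> (Q *v y)"
  have quadratic_nonneg: "0 \<le> a + 2 * t * b + t\<^sup>2 * c" for t
  proof -
    have "(x + t *\<^sub>R y) \<bullet> (Q *v (x + t *\<^sub>R y)) = a + t * (x \<bullet> (Q *v y)) + t * b + t\<^sup>2 * c"
      by (simp add: a_def b_def c_def algebra_simps power2_eq_square)
    then show ?thesis
      using psd[of "x + t *\<^sub>R y"] symmetric_matrix_inner_commute[OF sym, of x y] by (simp add: b_def)
  qed
  show ?thesis
  proof (cases "c = 0")
    case True
    have "b = 0"
    proof (rule ccontr)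
      assume "b \<noteq> 0"
      then have "a + 2 * (- (a + 1) / (2 * b)) * b = -1" by (simp add: field_simps)
      then show False using quadratic_nonneg[of "- (a + 1) / (2 * b)"] True by simp
    qed
    then show ?thesis using True by (simp add: b_def c_def)
  next
    case False
    then have "0 < c" using psd[of y] by (simp add: c_def)
    have "0 \<le> a + 2 * (- b / c) * b + (- b / c)\<^sup>2 * c" by (rule quadratic_nonneg)
    also have "\<dots> = (a * c - b\<^sup>2) / c" using \<open>0 < c\<close> by (simp add: field_simps power2_eq_square)
    finally show ?thesis using \<open>0 < c\<close> by (simp add: a_def b_def c_def zero_le_divide_iff)
  qed
qed

lemma psd_form_eq_0_imp_eq_0:
  fixes Q :: "real^'n^'n"
  assumes "transpose Q = Q" and "\<And>z. 0 \<le> z \<bullet> (Q *v z)" and "x \<bullet> (Q *v x) = 0"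
  shows "Q *v x = 0"
proof -
  have "((Q *v x) \<bullet> (Q *v x))\<^sup>2 \<le> 0"
    using psd_form_Cauchy_Schwarz[OF assms(1,2), where x=x and y="Q *v x"] assms(3) by simp
  then show ?thesis by simp
qed

lemma symmetric_matrix_max_eigenvector:
  fixes P :: "real^'n^'n"
  assumes sym: "transpose P = P"
  obtains M v where "v \<noteq> 0" and "P *v v = M *\<^sub>R v" and "\<And>x. x \<bullet> (P *v x) \<le> M * (norm x)\<^sup>2"
proof -
  have "sphere (0::real^'n) 1 \<noteq> {}" by simp
  moreover have "continuous_on (sphere 0 1) (\<lambda>x::real^'n. x \<bullet> (P *v x))"
    by (intro continuous_intros linear_continuous_on bounded_linear_intros matrix_vector_mul_bounded_linear)
  ultimately obtain v where v: "v \<in> sphere 0 1"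
    and v_max: "\<And>u. u \<in> sphere 0 1 \<Longrightarrow> u \<bullet> (P *v u) \<le> v \<bullet> (P *v v)"
    using continuous_attains_sup[OF compact_sphere] by blast
  define M where "M = v \<bullet> (P *v v)"
  have bound: "x \<bullet> (P *v x) \<le> M * (norm x)\<^sup>2" for x
  proof (cases "x = 0")
    case False
    have "(x /\<^sub>R norm x) \<bullet> (P *v (x /\<^sub>R norm x)) \<le> M"
      unfolding M_def using False by (intro v_max) simp
    moreover have "(x /\<^sub>R norm x) \<bullet> (P *v (x /\<^sub>R norm x)) = x \<bullet> (P *v x) / (norm x)\<^sup>2"
      by (simp add: matrix_vector_mult_scaleR power2_eq_square divide_inverse)
    ultimately show ?thesis
      using False by (simp add: divide_le_eq)
  qed simp
  (* v maximises the Rayleigh quotient, so it is a zero, hence a kernel vector, of the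
     positive semidefinite form of M I - P *)
  define Q where "Q = M *\<^sub>R mat 1 - P"
  have Q_apply: "Q *v x = M *\<^sub>R x - P *v x" for x
    by (simp add: Q_def matrix_vector_mult_diff_rdistrib scaleR_matrix_vector_assoc[symmetric])
  have "transpose Q = Q"
    using sym by (simp add: Q_def transpose_def vec_eq_iff mat_def)
  moreover have "0 \<le> z \<bullet> (Q *v z)" for z
    using bound[of z] by (simp add: Q_apply inner_diff_right power2_norm_eq_inner)
  moreover have "v \<bullet> (Q *v v) = 0"
    using v by (simp add: Q_apply inner_diff_right M_def power2_norm_eq_inner[symmetric])
  ultimately have "Q *v v = 0" by (rule psd_form_eq_0_imp_eq_0)
  then have "P *v v = M *\<^sub>R v" by (simp add: Q_apply)
  moreover have "v \<noteq> 0" using v by auto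
  ultimately show ?thesis using bound that by blast
qed

lemma real_eigenvalues_finite:
  fixes P :: "real^'n^'n"
  assumes sym: "transpose P = P"
  shows "finite (real_eigenvalues P)"
proof -
  (* one eigenvector per eigenvalue gives an orthogonal, hence independent, family *)
  define g where "g l = (SOME v. v \<noteq> 0 \<and> P *v v = l *\<^sub>R v)" for l
  have g: "g l \<noteq> 0" "P *v g l = l *\<^sub>R g l" if "l \<in> real_eigenvalues P" for l
    using someI_ex[OF that[unfolded real_eigenvalues_def mem_Collect_eq]] by (simp_all add: g_def)
  have orthogonal: "g a \<bullet> g b = 0"
    if "a \<in> real_eigenvalues P" "b \<in> real_eigenvalues P" "a \<noteq> b" for a b
  proof -
    have "b * (g a \<bullet> g b) = a * (g a \<bullet> g b)"
      using symmetric_matrix_inner_commute[OF sym, of "g a" "g b"] g[OF that(1)] g[OF that(2)]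
      by (simp add: inner_commute)
    then show ?thesis using \<open>a \<noteq> b\<close> by simp
  qed
  have inj: "inj_on g (real_eigenvalues P)"
    by (rule inj_onI) (metis g(1) inner_eq_zero_iff orthogonal)
  have "pairwise orthogonal (g ` real_eigenvalues P)"
    unfolding pairwise_def orthogonal_def by (metis imageE orthogonal)
  moreover have "0 \<notin> g ` real_eigenvalues P" by (metis g(1) imageE)
  ultimately have "finite (g ` real_eigenvalues P)"
    by (intro independent_imp_finite pairwise_orthogonal_independent)
  then show ?thesis using inj by (rule finite_imageD)
qed

lemma lambda_max_symmetric:
  fixes P :: "real^'n^'n"
  assumes sym: "transpose P = P"
  shows "lambda_max P \<in> real_eigenvalues P"
    and "x \<bullet> (P *v x) \<le> lambda_max P * (norm x)\<^sup>2"
proof -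
  obtain M v where "v \<noteq> 0" "P *v v = M *\<^sub>R v"
    and bound: "\<And>x. x \<bullet> (P *v x) \<le> M * (norm x)\<^sup>2"
    using symmetric_matrix_max_eigenvector[OF sym] by blast
  then have M: "M \<in> real_eigenvalues P" unfolding real_eigenvalues_def by blast
  have "lambda_max P = M" unfolding lambda_max_def
  proof (rule Max_eqI[OF real_eigenvalues_finite[OF sym] _ M])
    fix l assume "l \<in> real_eigenvalues P"
    then obtain w where "w \<noteq> 0" "P *v w = l *\<^sub>R w" unfolding real_eigenvalues_def by blast
    then have "l * (norm w)\<^sup>2 \<le> M * (norm w)\<^sup>2"
      using bound[of w] by (simp add: power2_norm_eq_inner)
    then show "l \<le> M" using \<open>w \<noteq> 0\<close> by simp
  qed
  then show "lambda_max P \<in> real_eigenvalues P" "x \<bullet> (P *v x) \<le> lambda_max P * (norm x)\<^sup>2"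
    using M bound by simp_all
qed

lemma real_eigenvalues_uminus: "real_eigenvalues (- P) = uminus ` real_eigenvalues P"
proof -
  have "l \<in> real_eigenvalues (- P) \<longleftrightarrow> - l \<in> real_eigenvalues P" for l
    unfolding real_eigenvalues_def
    by (auto simp: matrix_vector_mult_uminus_left minus_equation_iff[of "P *v _"])
  then show ?thesis by (force intro: image_eqI[where x = "- _"])
qed

lemma lambda_min_symmetric:
  fixes P :: "real^'n^'n"
  assumes sym: "transpose P = P"
  shows "lambda_min P \<in> real_eigenvalues P"
    and "lambda_min P * (norm x)\<^sup>2 \<le> x \<bullet> (P *v x)"
proof -
  have sym_uminus: "transpose (- P) = - P"
    using sym by (simp add: transpose_def vec_eq_iff)
  have "real_eigenvalues P \<noteq> {}" using lambda_max_symmetric(1)[OF sym] by blast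
  then have "lambda_min P = - lambda_max (- P)"
    unfolding lambda_min_def lambda_max_def real_eigenvalues_uminus
    using real_eigenvalues_finite[OF sym] by (simp add: image_image)
  then show "lambda_min P \<in> real_eigenvalues P" "lambda_min P * (norm x)\<^sup>2 \<le> x \<bullet> (P *v x)"
    using lambda_max_symmetric(1)[OF sym_uminus] lambda_max_symmetric(2)[OF sym_uminus, of x]
    by (auto simp: real_eigenvalues_uminus matrix_vector_mult_uminus_left)
qed

lemma real_eigenvalue_pos_if_sym_pos_def:
  assumes "sym_pos_def P" and "l \<in> real_eigenvalues P"
  shows "0 < l"
proof -
  obtain v where "v \<noteq> 0" "P *v v = l *\<^sub>R v" using assms(2) unfolding real_eigenvalues_def by blast
  then have "0 < l * (norm v)\<^sup>2"
    using assms(1) unfolding sym_pos_def_def by (metis inner_scaleR_right power2_norm_eq_inner)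
  then show ?thesis by (simp add: zero_less_mult_iff)
qed

lemma spec_norm_le_lambda_max:
  fixes P :: "real^'n^'n"
  assumes sym: "transpose P = P" and psd: "\<And>z. 0 \<le> z \<bullet> (P *v z)"
  shows "spec_norm P \<le> lambda_max P"
  unfolding spec_norm_def
proof (rule onorm_le)
  fix x :: "real^'n"
  define \<mu> y where "\<mu> = lambda_max P" and "y = P *v x"
  have bound: "z \<bullet> (P *v z) \<le> \<mu> * (norm z)\<^sup>2" for z
    unfolding \<mu>_def by (rule lambda_max_symmetric(2)[OF sym])
  have "0 \<le> \<mu>"
  proof -
    obtain v where "v \<noteq> 0" "P *v v = \<mu> *\<^sub>R v"
      using lambda_max_symmetric(1)[OF sym] unfolding \<mu>_def real_eigenvalues_def by blast
    then show ?thesis using psd[of v] by (simp add: zero_le_mult_iff) (meson inner_gt_zero_iff not_le)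
  qed
  have "(norm y)\<^sup>2 * (norm y)\<^sup>2 = (y \<bullet> (P *v x))\<^sup>2"
    by (simp add: y_def dot_square_norm power2_eq_square)
  also have "\<dots> \<le> (x \<bullet> (P *v x)) * (y \<bullet> (P *v y))"
    by (rule psd_form_Cauchy_Schwarz[OF sym psd])
  also have "\<dots> \<le> (\<mu> * (norm x)\<^sup>2) * (\<mu> * (norm y)\<^sup>2)"
    using \<open>0 \<le> \<mu>\<close> by (intro mult_mono bound psd) simp_all
  also have "\<dots> = (\<mu> * norm x)\<^sup>2 * (norm y)\<^sup>2"
    by (simp add: power2_eq_square)
  finally have "(norm y)\<^sup>2 * (norm y)\<^sup>2 \<le> (\<mu> * norm x)\<^sup>2 * (norm y)\<^sup>2" .
  then have "(norm y)\<^sup>2 \<le> (\<mu> * norm x)\<^sup>2"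
  proof (cases "y = 0")
    case False
    then show ?thesis by (intro mult_right_le_imp_le[OF \<open>(norm y)\<^sup>2 * _ \<le> _\<close>]) simp
  qed simp
  then have "norm y \<le> \<mu> * norm x"
    by (rule power2_le_imp_le) (simp add: \<open>0 \<le> \<mu>\<close>)
  then show "norm (P *v x) \<le> lambda_max P * norm x"
    by (simp add: y_def \<mu>_def)
qed

lemma form_abs_le_spec_norm:
  fixes M :: "real^'n^'n"
  shows "\<bar>x \<bullet> (M *v x)\<bar> \<le> spec_norm M * (norm x)\<^sup>2"
proof -
  have "\<bar>x \<bullet> (M *v x)\<bar> \<le> norm x * norm (M *v x)" by (rule Cauchy_Schwarz_ineq2)
  also have "\<dots> \<le> norm x * (spec_norm M * norm x)"
    unfolding spec_norm_def by (intro mult_left_mono onorm matrix_vector_mul_bounded_linear) simp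
  finally show ?thesis by (simp add: power2_eq_square mult_ac)
qed

lemma perturbed_sym_pos_def_form_bounds:
  fixes P Q :: "real^'n^'n" and \<delta> :: real
  assumes "sym_pos_def P" and "0 \<le> \<delta>" and "spec_norm (Q - P) \<le> \<delta> * spec_norm P"
  shows "(lambda_min P - \<delta> * lambda_max P) * (norm x)\<^sup>2 \<le> x \<bullet> (Q *v x)"
    and "x \<bullet> (Q *v x) \<le> (1 + \<delta>) * lambda_max P * (norm x)\<^sup>2"
proof -
  have sym: "transpose P = P"
    using assms(1) by (simp add: sym_pos_def_def)
  have psd: "0 \<le> z \<bullet> (P *v z)" for z
    using assms(1) unfolding sym_pos_def_def by (cases "z = 0") (auto simp: less_imp_le)
  have "spec_norm (Q - P) \<le> \<delta> * lambda_max P"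
    using assms(3) mult_left_mono[OF spec_norm_le_lambda_max[OF sym psd] assms(2)] by linarith
  then have "\<bar>x \<bullet> ((Q - P) *v x)\<bar> \<le> \<delta> * lambda_max P * (norm x)\<^sup>2"
    using form_abs_le_spec_norm[of x "Q - P"] mult_right_mono[of _ _ "(norm x)\<^sup>2"] by fastforce
  moreover have "x \<bullet> (Q *v x) = x \<bullet> (P *v x) + x \<bullet> ((Q - P) *v x)"
    by (simp add: matrix_vector_mult_diff_rdistrib inner_diff_right)
  moreover note lambda_min_symmetric(2)[OF sym, of x] lambda_max_symmetric(2)[OF sym, of x]
  ultimately show "(lambda_min P - \<delta> * lambda_max P) * (norm x)\<^sup>2 \<le> x \<bullet> (Q *v x)"
    and "x \<bullet> (Q *v x) \<le> (1 + \<delta>) * lambda_max P * (norm x)\<^sup>2"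
    unfolding left_diff_distrib distrib_right abs_le_iff by linarith+
qed

lemma trace_congruence_eq_sum_rows:
  fixes C :: "real^'n^'m" and M :: "real^'n^'n"
  shows "trace (C ** M ** transpose C) = (\<Sum>i\<in>UNIV. (C $ i) \<bullet> (M *v (C $ i)))"
  unfolding trace_def
proof (rule sum.cong[OF refl])
  fix i
  have "(C ** M ** transpose C) $ i $ i = (\<Sum>k\<in>UNIV. \<Sum>j\<in>UNIV. C $ i $ j * M $ j $ k * C $ i $ k)"
    by (simp add: matrix_matrix_mult_def transpose_def sum_distrib_right)
  also have "\<dots> = (\<Sum>j\<in>UNIV. \<Sum>k\<in>UNIV. C $ i $ j * M $ j $ k * C $ i $ k)"
    by (rule sum.swap)
  also have "\<dots> = (C $ i) \<bullet> (M *v (C $ i))"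
    by (simp add: matrix_vector_mult_def inner_vec_def sum_distrib_left mult.assoc)
  finally show "(C ** M ** transpose C) $ i $ i = (C $ i) \<bullet> (M *v (C $ i))" .
qed

lemma frob_norm_square_eq_sum_rows:
  fixes C :: "real^'n^'m"
  shows "(frob_norm C)\<^sup>2 = (\<Sum>i\<in>UNIV. (norm (C $ i))\<^sup>2)"
  unfolding frob_norm_def power2_norm_eq_inner
  by (simp add: sum_nonneg inner_vec_def power2_eq_square)

lemma trace_congruence_ge:
  fixes C :: "real^'n^'m" and M :: "real^'n^'n"
  assumes "\<And>x. a * (norm x)\<^sup>2 \<le> x \<bullet> (M *v x)"
  shows "a * (frob_norm C)\<^sup>2 \<le> trace (C ** M ** transpose C)"
  unfolding trace_congruence_eq_sum_rows frob_norm_square_eq_sum_rows sum_distrib_left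
  by (intro sum_mono assms)

lemma trace_congruence_le:
  fixes C :: "real^'n^'m" and M :: "real^'n^'n"
  assumes "\<And>x. x \<bullet> (M *v x) \<le> b * (norm x)\<^sup>2"
  shows "trace (C ** M ** transpose C) \<le> b * (frob_norm C)\<^sup>2"
  unfolding trace_congruence_eq_sum_rows frob_norm_square_eq_sum_rows sum_distrib_left
  by (intro sum_mono assms)

lemma trace_congruence_ratio_le:
  fixes C :: "real^'n^'m" and D :: "real^'n^'k" and M :: "real^'n^'n"
  assumes lower: "\<And>x. a * (norm x)\<^sup>2 \<le> x \<bullet> (M *v x)"
    and upper: "\<And>x. x \<bullet> (M *v x) \<le> b * (norm x)\<^sup>2"
    and "0 < a"
  shows "trace (C ** M ** transpose C) / trace (D ** M ** transpose D)
    \<le> b / a * ((frob_norm C)\<^sup>2 / (frob_norm D)\<^sup>2)"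
proof (cases "frob_norm D = 0")
  case True
  (* then both sides vanish, the right-hand one by the convention x / 0 = 0 *)
  then show ?thesis
    using trace_congruence_ge[OF lower, of D] trace_congruence_le[OF upper, of D] by simp
next
  case False
  define N where "N = trace (C ** M ** transpose C)"
  have "0 < a * (frob_norm D)\<^sup>2" using \<open>0 < a\<close> False by simp
  moreover have "a * (frob_norm D)\<^sup>2 \<le> trace (D ** M ** transpose D)"
    by (rule trace_congruence_ge[OF lower])
  moreover have "0 \<le> N"
    using order_trans[OF _ trace_congruence_ge[OF lower, of C]] \<open>0 < a\<close> by (simp add: N_def)
  ultimately have "N / trace (D ** M ** transpose D) \<le> N / (a * (frob_norm D)\<^sup>2)"
    by (intro divide_left_mono) auto
  also have "\<dots> \<le> b * (frob_norm C)\<^sup>2 / (a * (frob_norm D)\<^sup>2)"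
    using trace_congruence_le[OF upper, of C] \<open>0 < a * (frob_norm D)\<^sup>2\<close>
    by (simp add: N_def divide_right_mono)
  finally show ?thesis by (simp add: N_def)
qed

lemma frob_norm_brow:
  fixes A :: "real^'b^'a" and B :: "real^'d^'a"
  shows "(frob_norm (brow A B))\<^sup>2 = (frob_norm A)\<^sup>2 + (frob_norm B)\<^sup>2"
proof -
  have "(\<Sum>j\<in>UNIV. (brow A B $ i $ j)\<^sup>2) = (\<Sum>j\<in>UNIV. (A $ i $ j)\<^sup>2) + (\<Sum>j\<in>UNIV. (B $ i $ j)\<^sup>2)" for i
    unfolding UNIV_Plus_UNIV[symmetric] sum.Plus[OF finite finite] by (simp add: brow_def)
  then show ?thesis
    unfolding frob_norm_def by (simp add: sum_nonneg sum.distrib)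
qed

lemma frob_norm_uminus [simp]: "frob_norm (- A) = frob_norm (A :: real^'n^'m)"
  unfolding frob_norm_def by simp

lemma frob_norm_zero [simp]: "frob_norm (0 :: real^'n^'m) = 0"
  unfolding frob_norm_def by simp

theorem theorem1:
  fixes Ap :: "real^'x^'x" and Bp :: "real^'u^'x" and Bw Bwh :: "real^'x^'x"
    and Cmo :: "real^'x^'y" and Cpo :: "real^'x^'p" and Dpo :: "real^'u^'p"
    and K :: "real^'y^'x" and L :: "real^'x^'u" and R :: "real^'y^'y"
    and P PR :: "real^('x + 'x)^('x + 'x)" and \<delta>R :: real
  defines "A \<equiv> A_cl Ap Bp K L Cmo (mat 1)"
    and "A_R \<equiv> A_cl Ap Bp K L Cmo R"
    and "B \<equiv> blk Bw 0 Bw (- Bwh)"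
    and "CrR \<equiv> brow ((R - mat 1) ** Cmo) Cmo"
    and "Cp \<equiv> brow (Cpo + Dpo ** L) (- (Dpo ** L))"
    and "Cr \<equiv> brow (0 :: real^'x^'y) Cmo"
    and "ER \<equiv> (mat 1 - R) ** Cmo"
    and "\<Delta>PR \<equiv> PR - P"
  assumes "controllable Ap Bp"
    and "observable Ap Cmo"
    and "hurwitz A_R"
    and "sym_pos_def P"
    and "A ** P + P ** transpose A + B ** transpose B = 0"
    and "A_R ** PR + PR ** transpose A_R + B ** transpose B = 0"
    and "0 \<le> \<delta>R" and "\<delta>R < 1"
    and "spec_norm \<Delta>PR \<le> \<delta>R * spec_norm P"
    and "\<delta>R * cond_num P < 1"
  shows "trace (Cp ** PR ** transpose Cp) / trace (CrR ** PR ** transpose CrR)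
         \<le> (cond_num P * (1 + \<delta>R)) / (1 - \<delta>R * cond_num P)
           * ((frob_norm Cp)\<^sup>2 / ((frob_norm ER)\<^sup>2 + (frob_norm Cr)\<^sup>2))"
proof -
  have sym: "transpose P = P"
    using \<open>sym_pos_def P\<close> by (simp add: sym_pos_def_def)
  have "0 < lambda_min P"
    by (rule real_eigenvalue_pos_if_sym_pos_def[OF \<open>sym_pos_def P\<close> lambda_min_symmetric(1)[OF sym]])
  moreover have "0 < lambda_min P - \<delta>R * lambda_max P"
    using \<open>\<delta>R * cond_num P < 1\<close> \<open>0 < lambda_min P\<close> by (simp add: cond_num_def field_simps)
  ultimately have coefficient: "cond_num P * (1 + \<delta>R) / (1 - \<delta>R * cond_num P)
      = (1 + \<delta>R) * lambda_max P / (lambda_min P - \<delta>R * lambda_max P)"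
    by (simp add: cond_num_def field_simps)
  have "(R - mat 1) ** Cmo = - ER"
    unfolding ER_def by (metis minus_diff_eq matrix_mul_uminus_left)
  then have frob_CrR: "(frob_norm CrR)\<^sup>2 = (frob_norm ER)\<^sup>2 + (frob_norm Cr)\<^sup>2"
    unfolding CrR_def Cr_def by (simp add: frob_norm_brow)
  have "spec_norm (PR - P) \<le> \<delta>R * spec_norm P"
    using \<open>spec_norm \<Delta>PR \<le> \<delta>R * spec_norm P\<close> by (simp add: \<Delta>PR_def)
  with \<open>sym_pos_def P\<close> \<open>0 \<le> \<delta>R\<close> \<open>0 < lambda_min P - \<delta>R * lambda_max P\<close>
  have "trace (Cp ** PR ** transpose Cp) / trace (CrR ** PR ** transpose CrR)
      \<le> (1 + \<delta>R) * lambda_max P / (lambda_min P - \<delta>R * lambda_max P)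
        * ((frob_norm Cp)\<^sup>2 / (frob_norm CrR)\<^sup>2)"
    by (intro trace_congruence_ratio_le perturbed_sym_pos_def_form_bounds)
  then show ?thesis
    unfolding coefficient frob_CrR .
qed

end
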